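(* Let $(S,\cdot)$ be a commutative semigroup, let $B$ be a complex Banach algebra with unit $1_B$, let $g:S\to B$ and $\psi:S^2\to[0,\infty)$ be functions, and suppose $N_{\widehat g,\psi}\neq\emptyset$. Then for every function $f:S\to B$ satisfying $$\|f(x\cdot y)-g(x)f(y)\|\le\psi(x,y)\quad\text{for all }x,y\in S,$$ there exists a unique function $T:S\to B$ such that $$T(x\cdot y)=g(x)T(y)\quad\text{for all }x,y\in S$$ and $$\|f(y)-T(y)\|\le\inf_{a\in N_{\widehat g,\psi}}\frac{\psi(a,y)}{|\widehat g(a)|-1}\quad\text{for all }y\in S.$$ Moreover, this $T$ satisfies $(g(x\cdot y)-g(x)g(y))\,T(z)=0$ for all $x,y,z\in S$.
   Context: For $g:S\to B$, let $M_g=\{a\in S: g(a)\in\mathbb{C}\,1_B\}$ be the set of $a$ for which $g(a)$ is a complex scalar multiple of the unit. The function $\widehat g:S\to\mathbb{C}$ is defined by: $\widehat g(a)$ is the scalar with $\widehat g(a)\,1_B=g(a)$ if $a\in M_g$, and $\widehat g(a)=1$ if $a\notin M_g$. For a function $u:S\to\mathbb{C}$, the set $N_{u,\psi}$ consists of all $a\in S$ such that $|u(a)|>1$ and $\psi(x,y\cdot a)\le\psi(x,y)$ for all $x,y\in S$. *)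

theory Defs
  imports "HOL-Analysis.Analysis"
begin

text \<open>
  Complex unital Banach algebras: a real unital Banach algebra with a complex scalar
  multiplication that extends the real one. The unit is nonzero (a consequence of
  \<^class>\<open>ring_1\<close>), which makes the scalar representing an element of the line spanned by 1
  unique, but 1 is not required to have norm 1.
\<close>

class complex_banach_algebra_1 = real_normed_algebra + ring_1 + banach +
  fixes scaleC :: "complex \<Rightarrow> 'a \<Rightarrow> 'a"
  assumes scaleC_of_real: "scaleC (complex_of_real r) x = scaleR r x"
    and scaleC_add_right: "scaleC c (x + y) = scaleC c x + scaleC c y"
    and scaleC_add_left: "scaleC (c + d) x = scaleC c x + scaleC d x"
    and scaleC_scaleC: "scaleC c (scaleC d x) = scaleC (c * d) x"
    and mult_scaleC_left: "scaleC c x * y = scaleC c (x * y)"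
    and mult_scaleC_right: "x * scaleC c y = scaleC c (x * y)"
    and norm_scaleC: "norm (scaleC c x) = cmod c * norm x"

instantiation complex :: complex_banach_algebra_1
begin

definition "scaleC_complex = (\<lambda>(c::complex) (x::complex). c * x)"

instance
  by standard (simp_all add: scaleC_complex_def scaleR_conv_of_real algebra_simps norm_mult)

end

definition scalar_points :: "('s \<Rightarrow> 'b::complex_banach_algebra_1) \<Rightarrow> 's set" where
  "scalar_points g = {a. \<exists>c. g a = scaleC c 1}"

definition scalar_hat :: "('s \<Rightarrow> 'b::complex_banach_algebra_1) \<Rightarrow> 's \<Rightarrow> complex" where
  "scalar_hat g a = (if a \<in> scalar_points g then THE c. scaleC c 1 = g a else 1)"

definition N_set ::
  "('s::ab_semigroup_mult \<Rightarrow> complex) \<Rightarrow> ('s \<Rightarrow> 's \<Rightarrow> real) \<Rightarrow> 's set" where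
  "N_set u \<psi> = {a. cmod (u a) > 1 \<and> (\<forall>x y. \<psi> x (y * a) \<le> \<psi> x y)}"

lemma scaleC_one_inject:
  assumes "scaleC c (1::'b::complex_banach_algebra_1) = scaleC d 1"
  shows "c = d"
proof -
  have "scaleC (c - d) (1::'b) + scaleC d 1 = scaleC c 1"
    by (simp flip: scaleC_add_left)
  then have "norm (scaleC (c - d) (1::'b)) = 0"
    using assms by simp
  then show ?thesis
    by (simp add: norm_scaleC)
qed

lemma scalar_hat_scaleC:
  assumes "a \<in> scalar_points g"
  shows "scaleC (scalar_hat g a) 1 = g a"
proof -
  obtain c where c: "scaleC c 1 = g a"
    using assms by (auto simp: scalar_points_def)
  then have "(THE c. scaleC c 1 = g a) = c"
    by (metis (mono_tags, lifting) scaleC_one_inject the_equality)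
  with c assms show ?thesis
    by (simp add: scalar_hat_def)
qed

end

theory Submission
  imports Defs
begin

text \<open>
  For a single \<open>a\<close> in \<open>N\<close> with \<open>g a = c 1\<close>, the direct method of Hyers gives
  \<open>T y = lim c^(-n) f (a^n y)\<close>: the bound \<open>\<psi> a\<close> does not grow along the orbit of \<open>y\<close> under \<open>a\<close>,
  so consecutive terms differ by at most \<open>\<psi> a y / \<bar>c\<bar>^(n+1)\<close>. Two solutions whose distance
  does not grow along such an orbit coincide, since multiplying by \<open>a\<close> scales their
  difference by \<open>c\<close>. Hence the limits for different \<open>a\<close> agree, and the common limit satisfies
  all the bounds simultaneously.
\<close>

lemma scaleC_one [simp]: "scaleC 1 x = (x::'b::complex_banach_algebra_1)"
  using scaleC_of_real[of 1 x] by simp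

lemma scaleC_diff_right:
  "scaleC c (x - y) = scaleC c x - scaleC c (y::'b::complex_banach_algebra_1)"
  using scaleC_add_right[of c "x - y" y] by (simp add: algebra_simps)

lemma N_setD:
  fixes g :: "'s::ab_semigroup_mult \<Rightarrow> 'b::complex_banach_algebra_1"
  assumes "a \<in> N_set (scalar_hat g) \<psi>"
  shows "1 < cmod (scalar_hat g a)"
    and "g a = scaleC (scalar_hat g a) 1"
    and "\<psi> x (a * y) \<le> \<psi> x y"
proof -
  show gt: "1 < cmod (scalar_hat g a)"
    using assms by (simp add: N_set_def)
  \<comment> \<open>Off \<open>scalar_points g\<close> the default value of
    \<open>scalar_hat\<close> is 1, whose modulus is not greater than 1.\<close>
  then have "a \<in> scalar_points g"
    by (auto simp: scalar_hat_def split: if_splits)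
  then show "g a = scaleC (scalar_hat g a) 1"
    by (simp add: scalar_hat_scaleC)
  show "\<psi> x (a * y) \<le> \<psi> x y"
    using assms by (simp add: N_set_def mult.commute[of a y])
qed

lemma funpow_mult_left_commute:
  fixes a x y :: "'s::ab_semigroup_mult"
  shows "((*) a ^^ n) (x * y) = x * ((*) a ^^ n) y"
  by (induction n) (simp_all add: mult.left_commute)

lemma funpow_orbit_le:
  fixes h :: "'s \<Rightarrow> real"
  assumes "\<And>y. h (p y) \<le> h y"
  shows "h ((p ^^ n) y) \<le> h y"
proof (induction n)
  case (Suc n)
  then show ?case
    using assms[of "(p ^^ n) y"] by simp
qed simp

lemma g_homogeneous_eqI:
  fixes g T T' :: "'s::ab_semigroup_mult \<Rightarrow> 'b::complex_banach_algebra_1"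
  assumes T: "\<And>y. T (a * y) = g a * T y"
    and T': "\<And>y. T' (a * y) = g a * T' y"
    and ga: "g a = scaleC c 1" and c: "1 < cmod c"
    and bound: "\<And>y. norm (T y - T' y) \<le> K y"
    and K: "\<And>y. K (a * y) \<le> K y"
  shows "T = T'"
proof
  fix y
  \<comment> \<open>An exact equality although the norm of B is only submultiplicative:
    \<open>g a\<close> acts as the scalar \<open>c\<close>, and \<open>norm_scaleC\<close> is an
    equality.\<close>
  have pow: "norm (T (((*) a ^^ n) y) - T' (((*) a ^^ n) y)) = cmod c ^ n * norm (T y - T' y)"
    for n
    by (induction n)
      (simp_all add: T T' ga mult_scaleC_left norm_scaleC flip: scaleC_diff_right)
  have le: "cmod c ^ n * norm (T y - T' y) \<le> K y" for n
    using bound[of "((*) a ^^ n) y"] funpow_orbit_le[of K "(*) a" n y, OF K]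
    by (simp add: pow)
  show "T y = T' y"
  proof (rule ccontr)
    assume "T y \<noteq> T' y"
    then have pos: "0 < norm (T y - T' y)"
      by simp
    obtain n where "K y / norm (T y - T' y) < cmod c ^ n"
      using real_arch_pow[OF c] by blast
    with pos le[of n] show False
      by (simp add: field_simps)
  qed
qed

lemma Hyers_approximation:
  fixes f g :: "'s::ab_semigroup_mult \<Rightarrow> 'b::complex_banach_algebra_1"
  assumes ga: "g a = scaleC c 1" and c: "1 < cmod c"
    and mono: "\<And>x y. \<psi> x (a * y) \<le> \<psi> x y"
    and approx: "\<And>x y. norm (f (x * y) - g x * f y) \<le> \<psi> x y"
  obtains T where "\<And>x y. T (x * y) = g x * T y"
    and "\<And>y. norm (f y - T y) \<le> \<psi> a y / (cmod c - 1)"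
proof -
  define p where "p n y = ((*) a ^^ n) y" for n y
  define q where "q n y = scaleC (inverse c ^ n) (f (p n y))" for n y
  define r where "r = inverse (cmod c)"
  have c0: "c \<noteq> 0" and r: "0 < r" "r < 1"
    using c by (auto simp: r_def inverse_less_1_iff)
  have psi_p: "\<psi> x (p n y) \<le> \<psi> x y" for x n y
    unfolding p_def by (rule funpow_orbit_le) (rule mono)
  have step: "norm (q (Suc n) y - q n y) \<le> (\<psi> a y * r) * r ^ n" for n y
  proof -
    \<comment> \<open>Trading one factor \<open>c\<close> for \<open>g a\<close> brings both terms
      to the same power of \<open>inverse c\<close>, so their difference is a multiple of the defect
      of \<open>f\<close> at \<open>a\<close> and \<open>p n y\<close>.\<close>
    have "inverse c ^ Suc n * c = inverse c ^ n"
      using c0 by (simp add: field_simps)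
    then have "q n y = scaleC (inverse c ^ Suc n) (g a * f (p n y))"
      by (simp only: q_def ga mult_scaleC_left scaleC_scaleC mult_1_left)
    moreover have "q (Suc n) y = scaleC (inverse c ^ Suc n) (f (a * p n y))"
      by (simp add: q_def p_def)
    ultimately have "norm (q (Suc n) y - q n y)
        = r ^ Suc n * norm (f (a * p n y) - g a * f (p n y))"
      by (simp only: norm_scaleC norm_power norm_inverse r_def flip: scaleC_diff_right)
    also have "\<dots> \<le> r ^ Suc n * \<psi> a y"
      using r order_trans[OF approx psi_p] by (intro mult_left_mono) auto
    finally show ?thesis
      by (simp add: mult_ac)
  qed
  \<comment> \<open>The constant of the final bound arises here: r / (1 - r) = 1 / (|c| - 1) for r =
    1 / |c|.\<close>
  have geom: "(\<lambda>n. (\<psi> a y * r) * r ^ n) sums (\<psi> a y / (cmod c - 1))" for y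
  proof -
    have "(\<psi> a y * r) * (1 / (1 - r)) = \<psi> a y / (cmod c - 1)"
      using c c0 by (simp add: r_def field_simps)
    with sums_mult[OF geometric_sums[of r], of "\<psi> a y * r"] r show ?thesis
      by simp
  qed
  \<comment> \<open>Writing the limit of \<open>q n y\<close> as a telescoping series that starts
    from \<open>q 0 y = f y\<close> turns the distance from \<open>f y\<close> to \<open>T y\<close>
    into the norm of a series dominated by \<open>geom\<close>.\<close>
  define T where "T y = f y + (\<Sum>n. q (Suc n) y - q n y)" for y
  have summ: "summable (\<lambda>n. norm (q (Suc n) y - q n y))" for y
    by (rule summable_comparison_test'[OF sums_summable[OF geom[of y]], of 0])
      (simp add: step)
  have lim: "(\<lambda>n. q n y) \<longlonglongrightarrow> T y" for y
  proof -
    have "(\<lambda>n. f y + (\<Sum>k<n. q (Suc k) y - q k y)) \<longlonglongrightarrow> T y"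
      unfolding T_def
      by (rule tendsto_add[OF tendsto_const summable_LIMSEQ[OF summable_norm_cancel[OF summ]]])
    moreover have "f y + (\<Sum>k<n. q (Suc k) y - q k y) = q n y" for n
      using sum_lessThan_telescope[of "\<lambda>k. q k y" n] by (simp add: q_def p_def)
    ultimately show ?thesis
      by simp
  qed
  show thesis
  proof
    fix x y
    \<comment> \<open>By commutativity the powers of \<open>a\<close> slide past \<open>x\<close>,
      so the defect of \<open>q n\<close> is \<open>inverse c ^ n\<close> times that of
      \<open>f\<close> at \<open>x\<close> and \<open>p n y\<close>, where \<psi> has not
      grown.\<close>
    have "norm (q n (x * y) - g x * q n y) \<le> \<psi> x y * r ^ n" for n
    proof -
      have "q n (x * y) - g x * q n y
          = scaleC (inverse c ^ n) (f (x * p n y) - g x * f (p n y))"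
        by (simp add: q_def p_def funpow_mult_left_commute mult_scaleC_right scaleC_diff_right)
      then have "norm (q n (x * y) - g x * q n y)
          = r ^ n * norm (f (x * p n y) - g x * f (p n y))"
        by (simp only: norm_scaleC norm_power norm_inverse r_def)
      also have "\<dots> \<le> r ^ n * \<psi> x y"
        using r order_trans[OF approx psi_p] by (intro mult_left_mono) auto
      finally show ?thesis
        by (simp add: mult_ac)
    qed
    moreover have "(\<lambda>n. \<psi> x y * r ^ n) \<longlonglongrightarrow> 0"
      using r by (simp add: tendsto_mult_right_zero LIMSEQ_power_zero)
    ultimately have "(\<lambda>n. q n (x * y) - g x * q n y) \<longlonglongrightarrow> 0"
      by (rule Lim_null_comparison[OF always_eventually[OF allI]])
    moreover have "(\<lambda>n. q n (x * y) - g x * q n y) \<longlonglongrightarrow> T (x * y) - g x * T y"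
      by (intro tendsto_intros lim)
    ultimately have "T (x * y) - g x * T y = 0"
      by (rule LIMSEQ_unique[rotated])
    then show "T (x * y) = g x * T y"
      by simp
  next
    fix y
    have "norm (f y - T y) = norm (\<Sum>n. q (Suc n) y - q n y)"
      by (simp add: T_def)
    also have "\<dots> \<le> (\<Sum>n. norm (q (Suc n) y - q n y))"
      by (rule summable_norm[OF summ])
    also have "\<dots> \<le> (\<Sum>n. (\<psi> a y * r) * r ^ n)"
      by (intro suminf_le step summ sums_summable[OF geom])
    also have "\<dots> = \<psi> a y / (cmod c - 1)"
      by (rule sums_unique[OF geom, symmetric])
    finally show "norm (f y - T y) \<le> \<psi> a y / (cmod c - 1)" .
  qed
qed

theorem theorem2p7:
  fixes g :: "'s::ab_semigroup_mult \<Rightarrow> 'b::complex_banach_algebra_1"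
    and \<psi> :: "'s \<Rightarrow> 's \<Rightarrow> real"
    and f :: "'s \<Rightarrow> 'b"
  assumes psi_nonneg: "\<And>x y. 0 \<le> \<psi> x y"
    and N_nonempty: "N_set (scalar_hat g) \<psi> \<noteq> {}"
    and f_approx: "\<And>x y. norm (f (x * y) - g x * f y) \<le> \<psi> x y"
  shows "(\<exists>!T :: 's \<Rightarrow> 'b.
            (\<forall>x y. T (x * y) = g x * T y) \<and>
            (\<forall>y. norm (f y - T y) \<le>
              (INF a \<in> N_set (scalar_hat g) \<psi>. \<psi> a y / (cmod (scalar_hat g a) - 1)))) \<and>
         (\<forall>T :: 's \<Rightarrow> 'b.
            (\<forall>x y. T (x * y) = g x * T y) \<and>
            (\<forall>y. norm (f y - T y) \<le>
              (INF a \<in> N_set (scalar_hat g) \<psi>. \<psi> a y / (cmod (scalar_hat g a) - 1)))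
            \<longrightarrow> (\<forall>x y z. (g (x * y) - g x * g y) * T z = 0))"
proof -
  let ?N = "N_set (scalar_hat g) \<psi>"
  let ?b = "\<lambda>a y. \<psi> a y / (cmod (scalar_hat g a) - 1)"
  let ?hom = "\<lambda>T. \<forall>x y. T (x * y) = g x * T y"
  have b_nonneg: "0 \<le> ?b a y" if "a \<in> ?N" for a y
    using N_setD(1)[OF that] psi_nonneg by simp
  have b_orbit: "?b a (b * y) \<le> ?b a y" if "a \<in> ?N" "b \<in> ?N" for a b y
    using N_setD(1)[OF that(1)] N_setD(3)[OF that(2)] by (simp add: divide_right_mono)
  \<comment> \<open>For a real infimum this takes a nonempty index set and a lower bound, here
    0.\<close>
  have le_INF_iff: "t \<le> (INF a \<in> ?N. ?b a y) \<longleftrightarrow> (\<forall>a\<in>?N. t \<le> ?b a y)" for t y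
    by (rule le_cINF_iff[OF N_nonempty]) (auto intro!: bdd_belowI2[where m = 0] b_nonneg)
  \<comment> \<open>The two bounds may come from different points of \<open>?N\<close>. Their sum
    still does not grow along the orbit under \<open>a\<close>, since membership of \<open>a\<close>
    controls \<psi> for every first argument, including \<open>a'\<close>.\<close>
  have agree: "T = T'"
    if "?hom T" "?hom T'" "a \<in> ?N" "a' \<in> ?N"
      and T: "\<And>y. norm (f y - T y) \<le> ?b a y" and T': "\<And>y. norm (f y - T' y) \<le> ?b a' y"
    for T T' a a'
  proof (rule g_homogeneous_eqI[where g = g and a = a and c = "scalar_hat g a"
        and K = "\<lambda>y. ?b a y + ?b a' y"])
    show "norm (T y - T' y) \<le> ?b a y + ?b a' y" for y
      using norm_triangle_le_diff[of "f y - T' y" "f y - T y"] T[of y] T'[of y] by simp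
    show "?b a (a * y) + ?b a' (a * y) \<le> ?b a y + ?b a' y" for y
      using that by (intro add_mono b_orbit)
  qed (use that(1,2) N_setD(1,2)[OF that(3)] in blast)+
  obtain a0 where a0: "a0 \<in> ?N"
    using N_nonempty by blast
  have ex: "\<exists>T. ?hom T \<and> (\<forall>y. norm (f y - T y) \<le> ?b a y)" if "a \<in> ?N" for a
    by (rule Hyers_approximation[OF N_setD(2,1,3)[OF that] f_approx]) blast
  obtain T where T: "?hom T" "\<And>y. norm (f y - T y) \<le> ?b a0 y"
    using ex[OF a0] by blast
  \<comment> \<open>The solution built from \<open>a\<close> equals the one built from
    \<open>a0\<close>, so \<open>T\<close> inherits its bound.\<close>
  have T_all: "norm (f y - T y) \<le> ?b a y" if a: "a \<in> ?N" for a y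
  proof -
    obtain T' where T': "?hom T'" "\<And>y. norm (f y - T' y) \<le> ?b a y"
      using ex[OF a] by blast
    have "T = T'"
      by (rule agree[OF T(1) T'(1) a0 a T(2) T'(2)])
    with T'(2) show ?thesis
      by simp
  qed
  have uniq: "T' = T" if "?hom T'" "\<forall>y. \<forall>a\<in>?N. norm (f y - T' y) \<le> ?b a y" for T'
    by (rule agree[OF that(1) T(1) a0 a0 _ T(2)]) (use that(2) a0 in blast)
  \<comment> \<open>Associativity gives two evaluations of \<open>T'\<close> at the product of
    \<open>x\<close>, \<open>y\<close> and \<open>z\<close>: splitting off \<open>x * y\<close> at
    once, or \<open>x\<close> and then \<open>y\<close>.\<close>
  have defect: "(g (x * y) - g x * g y) * T' z = 0" if hom: "?hom T'" for T' x y z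
  proof -
    have "g (x * y) * T' z = T' (x * (y * z))"
      by (metis hom mult.assoc)
    also have "\<dots> = g x * g y * T' z"
      by (metis hom mult.assoc)
    finally show ?thesis
      by (simp add: left_diff_distrib)
  qed
  show ?thesis
    unfolding le_INF_iff
  proof (rule conjI)
    show "\<exists>!T. ?hom T \<and> (\<forall>y. \<forall>a\<in>?N. norm (f y - T y) \<le> ?b a y)"
      by (rule ex1I[of _ T]) (use T(1) T_all uniq in blast)+
  qed (use defect in blast)
qed

end
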